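(* Let $V$ be a valuation domain and let $I$ be a nonzero integral ideal of $V$. Then: (1) $\tilde{I}=V$ if and only if $I$ is an idempotent prime ideal of $V$ (that is, $I$ is prime and $I^2=I$). (2) Assume that $\tilde{I}\subsetneq V$. Then either $\tilde{I}=I$, or $\tilde{I}=(IQ:_V Q)$ for some nonzero prime ideal $Q$ of $V$.
   Context: For an integral domain $R$ and ideals $A,B$ of $R$, $(A:_R B)=\{x\in R : xB\subseteq A\}$. For a nonzero (integral) ideal $I$ of $R$, the Ratliff-Rush closure of $I$ is the ideal $\tilde{I}=\bigcup_{n\ge 1}(I^{n+1}:_R I^n)$. Here $R=V$.
   Formalization: Part (1) is stated only for I ≠ V: for I = V the closure is V, but V is not a prime ideal (prime ideals are proper), so the equivalence fails there; part (2) is unchanged. *)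

theory Defs
  imports "HOL-Algebra.Algebra"
begin

text \<open>
  Stated inside the ring itself: writing an element of the quotient field as a/b, the condition
  that it or its inverse lies in R says that b divides a or a divides b.
\<close>
locale valuation_domain = domain +
  assumes divides_total:
    "\<lbrakk>a \<in> carrier R; b \<in> carrier R\<rbrakk> \<Longrightarrow> a divides\<^bsub>R\<^esub> b \<or> b divides\<^bsub>R\<^esub> a"

abbreviation ideal_pow :: "('a, 'b) ring_scheme \<Rightarrow> 'a set \<Rightarrow> nat \<Rightarrow> 'a set"
  where "ideal_pow R I n \<equiv> I [^]\<^bsub>ideals_set R\<^esub> n"

definition colon_ideal :: "('a, 'b) ring_scheme \<Rightarrow> 'a set \<Rightarrow> 'a set \<Rightarrow> 'a set"
  where "colon_ideal R A B = {x \<in> carrier R. \<forall>b\<in>B. x \<otimes>\<^bsub>R\<^esub> b \<in> A}"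

definition ratliff_rush :: "('a, 'b) ring_scheme \<Rightarrow> 'a set \<Rightarrow> 'a set"
  where "ratliff_rush R I = (\<Union>n\<in>{1..}. colon_ideal R (ideal_pow R I (n + 1)) (ideal_pow R I n))"

end

theory Submission
  imports Defs
begin

text \<open>
  Let \<open>I\<close> be a nonzero ideal of a valuation domain \<open>V\<close>. Every element of a product of two ideals is a
  single product, because of any two summands one divides the other.

  If \<open>I\<close> is proper and has Ratliff-Rush closure \<open>V\<close>, then \<open>I\<^sup>n = I\<^sup>n\<^sup>+\<^sup>1\<close> for some \<open>n \<ge> 1\<close>, so \<open>J = I\<^sup>n\<close> is
  idempotent. A proper idempotent ideal \<open>J\<close> of a valuation domain is prime: if \<open>a \<notin> J\<close>, then
  \<open>J \<subseteq> aV\<close>, hence \<open>J = J\<^sup>2 \<subseteq> aJ\<close>, and \<open>ab \<in> J\<close> gives \<open>b \<in> J\<close>. Since \<open>a\<^sup>n \<in> J\<close> for each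
  \<open>a \<in> I\<close>, it follows that \<open>I = J\<close>.

  For the second part, let \<open>Q\<close> be the set of all \<open>q \<in> V\<close> with \<open>qI \<noteq> I\<close>. It is a prime ideal that
  contains \<open>I\<close> if \<open>I\<close> is proper; \<open>V\<^sub>Q\<close> is the ring of multipliers of \<open>I\<close> in the quotient
  field. There are two cases.

  If \<open>I \<noteq> IQ\<close>, then any \<open>a \<in> I\<close> outside \<open>IQ\<close> generates \<open>I\<close> over \<open>V\<^sub>Q\<close>, so \<open>a\<close> can be cancelled
  and the closure of \<open>I\<close> is \<open>I\<close> (lemma \<open>ratliff_rush_eq_self\<close>).

  If \<open>I = IQ\<close>, then the closure is \<open>(I : Q)\<close> (lemma \<open>ratliff_rush_eq_colon\<close>). One inclusion
  is immediate: \<open>yQ \<subseteq> I\<close> implies \<open>yI = yQI \<subseteq> I\<^sup>2\<close>. For the other, let \<open>yI\<^sup>n \<subseteq> I\<^sup>n\<^sup>+\<^sup>1\<close>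
  and \<open>g \<in> Q\<close>. There is an \<open>h \<in> Q\<close> with \<open>h\<^sup>n\<close> dividing \<open>g\<close>, and as \<open>hI \<noteq> I\<close> there is an
  \<open>x \<in> I\<close> that divides \<open>hw\<close> for every \<open>w \<in> I\<close>. Writing \<open>yx\<^sup>n = z w\<close> with \<open>z \<in> I\<close> and
  \<open>w \<in> I\<^sup>n\<close>, the element \<open>x\<^sup>n\<close> divides \<open>h\<^sup>n w\<close>, so \<open>z\<close> divides \<open>yh\<^sup>n\<close>, which divides \<open>yg\<close>;
  thus \<open>yg \<in> I\<close>.
\<close>

section \<open>Powers of ideals and the Ratliff-Rush closure\<close>

lemma ideals_set_one_mult [simp]:
  "\<one>\<^bsub>ideals_set R\<^esub> = carrier R" "I \<otimes>\<^bsub>ideals_set R\<^esub> J = I \<cdot>\<^bsub>R\<^esub> J"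
  by (simp_all add: ideals_set_def)

lemma ideal_pow_Suc: "ideal_pow R I (Suc n) = ideal_pow R I n \<cdot>\<^bsub>R\<^esub> I"
  by simp

context cring
begin

lemma ideal_pow_ideal:
  assumes "ideal I R"
  shows "ideal (ideal_pow R I n) R"
  by (induction n) (simp_all add: ideal_pow_Suc oneideal ideal_prod_is_ideal assms)

lemma ideal_pow_1:
  assumes "ideal I R"
  shows "ideal_pow R I (Suc 0) = I"
  using ideal_prod_one[OF assms] ideal_prod_commute[OF assms oneideal]
  by (simp add: ideal_pow_Suc)

lemma ideal_pow_2:
  assumes "ideal I R"
  shows "ideal_pow R I 2 = I \<cdot> I"
  using ideal_pow_1[OF assms] by (simp only: numeral_2_eq_2 ideal_pow_Suc)

lemma ideal_pow_Suc_subset: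
  assumes "ideal I R"
  shows "ideal_pow R I (Suc n) \<subseteq> I"
  using ideal_prod_inter[OF ideal_pow_ideal[OF assms] assms] by (auto simp: ideal_pow_Suc)

lemma pow_mem_ideal_pow:
  assumes "ideal I R" "a \<in> I"
  shows "a [^] n \<in> ideal_pow R I n"
  by (induction n) (simp_all add: ideal_pow_Suc ideal_prod.prod assms)

lemma mem_ideal_if_divides:
  assumes "ideal I R" "a \<in> I" "a divides b"
  shows "b \<in> I"
  using assms ideal.I_r_closed[OF assms(1)] by (auto elim: dividesE)

lemma mem_ratliff_rushE:
  assumes "y \<in> ratliff_rush R I"
  obtains n where "n \<ge> 1" "y \<in> carrier R"
    "\<And>b. b \<in> ideal_pow R I n \<Longrightarrow> y \<otimes> b \<in> ideal_pow R I (Suc n)"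
  using assms by (auto simp: ratliff_rush_def colon_ideal_def)

lemma ratliff_rushI_square:
  assumes "ideal I R" "y \<in> carrier R" "\<And>b. b \<in> I \<Longrightarrow> y \<otimes> b \<in> I \<cdot> I"
  shows "y \<in> ratliff_rush R I"
  unfolding ratliff_rush_def colon_ideal_def
  using assms ideal_pow_1[OF assms(1)] ideal_pow_2[OF assms(1)]
  by (auto simp: numeral_2_eq_2 intro!: bexI[of _ "Suc 0"])

lemma ratliff_rush_subset_carrier: "ratliff_rush R I \<subseteq> carrier R"
  by (auto simp: ratliff_rush_def colon_ideal_def)

lemma subset_ratliff_rush:
  assumes "ideal I R"
  shows "I \<subseteq> ratliff_rush R I"
  using ideal.Icarr[OF assms] by (auto intro!: ratliff_rushI_square[OF assms] ideal_prod.prod)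

lemma primeideal_pow_imp_mem:
  assumes "primeideal J R" "a \<in> carrier R" "a [^] (n::nat) \<in> J"
  shows "a \<in> J"
  using assms(3)
proof (induction n)
  case 0
  then have "\<one> \<in> J"
    by simp
  then show ?case
    using ideal.one_imp_carrier[OF primeideal.axioms(1)[OF assms(1)]] assms(2) by simp
next
  case (Suc n)
  then show ?case
    using primeideal.I_prime[OF assms(1), of "a [^] n" a] assms(2) by auto
qed

lemma one_divides:
  assumes "a \<in> carrier R"
  shows "\<one> divides a"
  using assms unit_divides by blast

lemma divides_pow_mono:
  assumes "a \<in> carrier R" "b \<in> carrier R" "a divides b"
  shows "a [^] (n::nat) divides b [^] n"
proof -
  obtain c where "c \<in> carrier R" "b = a \<otimes> c"
    using assms by (auto elim: dividesE)
  then show ?thesis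
    using assms by (auto simp: nat_pow_distrib)
qed

end

section \<open>Ideals of a valuation domain\<close>

context valuation_domain
begin

lemma divides_if_not_mem_ideal:
  assumes "ideal I R" "x \<in> I" "y \<in> carrier R" "y \<notin> I"
  shows "y divides x"
  using divides_total[of x y] mem_ideal_if_divides[of I x y] ideal.Icarr[OF assms(1)] assms
  by blast

lemma mem_ideal_prodE:
  assumes "ideal A R" "ideal B R" "z \<in> A \<cdot> B"
  obtains a b where "a \<in> A" "b \<in> B" "z = a \<otimes> b"
proof -
  have carr: "a \<in> carrier R" if "a \<in> A" for a
    using ideal.Icarr[OF assms(1) that] .
  have carr': "b \<in> carrier R" if "b \<in> B" for b
    using ideal.Icarr[OF assms(2) that] .
  have multiple: "\<exists>a'\<in>A. \<exists>b'\<in>B. s = a' \<otimes> b'"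
    if "a \<in> A" "b \<in> B" "(a \<otimes> b) divides s" for a b s
  proof -
    obtain c where "c \<in> carrier R" "s = a \<otimes> b \<otimes> c"
      using \<open>(a \<otimes> b) divides s\<close> by (auto elim: dividesE)
    then have "s = a \<otimes> (b \<otimes> c)" "b \<otimes> c \<in> B"
      using that carr carr' ideal.I_r_closed[OF assms(2)] by (auto simp: m_assoc)
    then show ?thesis
      using \<open>a \<in> A\<close> by blast
  qed
  have divides_sum: "s divides (s \<oplus> t)"
    if s: "s \<in> carrier R" and st: "s divides t" for s t
  proof -
    obtain c where "c \<in> carrier R" "t = s \<otimes> c"
      using st by (auto elim: dividesE)
    then have "s \<oplus> t = s \<otimes> (\<one> \<oplus> c)" "\<one> \<oplus> c \<in> carrier R"
      using s by (auto simp: r_distr)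
    then show ?thesis
      by blast
  qed
  from assms(3) have "\<exists>a\<in>A. \<exists>b\<in>B. z = a \<otimes> b"
  proof (induction z rule: ideal_prod.induct)
    case (prod i j)
    then show ?case
      by blast
  next
    case (sum s t)
    then obtain a b a' b' where *: "a \<in> A" "b \<in> B" "s = a \<otimes> b" "a' \<in> A" "b' \<in> B" "t = a' \<otimes> b'"
      by blast
    have carr_st: "s \<in> carrier R" "t \<in> carrier R"
      using * carr carr' by auto
    consider "s divides t" | "t divides s"
      using divides_total carr_st by blast
    then have "s divides (s \<oplus> t) \<or> t divides (s \<oplus> t)"
      using divides_sum[of s t] divides_sum[of t s] a_comm carr_st by auto
    then show ?case
      using multiple[of a b] multiple[of a' b'] * by blast
  qed
  then show thesis
    using that by blast
qed

lemma idempotent_imp_primeideal: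
  assumes "ideal J R" "J \<noteq> carrier R" "J \<cdot> J = J"
  shows "primeideal J R"
proof (rule primeidealI[OF assms(1) is_cring])
  show "carrier R \<noteq> J"
    using assms(2) by simp
next
  fix a b
  assume ab: "a \<in> carrier R" "b \<in> carrier R" "a \<otimes> b \<in> J"
  show "a \<in> J \<or> b \<in> J"
  proof (cases "a \<in> J")
    case False
    obtain u v where uv: "u \<in> J" "v \<in> J" "a \<otimes> b = u \<otimes> v"
      using mem_ideal_prodE[OF assms(1,1)] ab(3) assms(3) by metis
    obtain c where c: "c \<in> carrier R" "u = a \<otimes> c"
      using divides_if_not_mem_ideal[OF assms(1) uv(1) ab(1) False] by (auto elim: dividesE)
    have "v \<in> carrier R"
      using ideal.Icarr[OF assms(1) uv(2)] .
    then have "a \<otimes> b = a \<otimes> (c \<otimes> v)"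
      using uv(3) c ab(1) by (simp add: m_assoc)
    moreover have "a \<noteq> \<zero>"
      using False additive_subgroup.zero_closed[OF ideal.axioms(1)[OF assms(1)]] by auto
    ultimately have "b = c \<otimes> v"
      using m_lcancel[of a b "c \<otimes> v"] ab c \<open>v \<in> carrier R\<close> by simp
    then show ?thesis
      using ideal.I_l_closed[OF assms(1) uv(2) c(1)] by simp
  qed simp
qed

lemma ratliff_rush_eq_carrier_iff:
  assumes I: "ideal I R" and proper: "I \<noteq> carrier R"
  shows "ratliff_rush R I = carrier R \<longleftrightarrow> primeideal I R \<and> ideal_pow R I 2 = I"
proof
  assume "primeideal I R \<and> ideal_pow R I 2 = I"
  then have "I \<cdot> I = I"
    using ideal_pow_2[OF I] by simp
  then have "y \<in> ratliff_rush R I" if "y \<in> carrier R" for y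
    using that ideal.I_l_closed[OF I] by (auto intro!: ratliff_rushI_square[OF I])
  then show "ratliff_rush R I = carrier R"
    using ratliff_rush_subset_carrier by blast
next
  assume "ratliff_rush R I = carrier R"
  then have "\<one> \<in> ratliff_rush R I"
    by simp
  then obtain n where n: "n \<ge> 1"
    and *: "\<And>b. b \<in> ideal_pow R I n \<Longrightarrow> \<one> \<otimes> b \<in> ideal_pow R I (Suc n)"
    by (auto elim: mem_ratliff_rushE)
  define J where "J = ideal_pow R I n"
  have J: "ideal J R"
    unfolding J_def by (rule ideal_pow_ideal[OF I])
  have "J \<subseteq> J \<cdot> I"
    using * ideal.Icarr[OF J] by (auto simp: J_def ideal_pow_Suc)
  then have JI: "J \<cdot> I = J"
    using ideal_prod_inter[OF J I] by blast
  have "J \<cdot> ideal_pow R I k = J" for k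
  proof (induction k)
    case 0
    show ?case
      using ideal_prod_one[OF J] by simp
  next
    case (Suc k)
    then show ?case
      using ideal_prod_assoc[OF J ideal_pow_ideal[OF I] I, of k] JI by (simp add: ideal_pow_Suc)
  qed
  then have JJ: "J \<cdot> J = J"
    unfolding J_def .
  have "J \<subseteq> I"
    using n ideal_pow_Suc_subset[OF I, of "n - 1"] by (simp add: J_def)
  then have "J \<noteq> carrier R"
    using proper ideal.Icarr[OF I] by blast
  then have prime: "primeideal J R"
    using idempotent_imp_primeideal J JJ by blast
  have "I \<subseteq> J"
    using primeideal_pow_imp_mem[OF prime] pow_mem_ideal_pow[OF I] ideal.Icarr[OF I]
    unfolding J_def by blast
  then have "I = J"
    using \<open>J \<subseteq> I\<close> by blast
  then show "primeideal I R \<and> ideal_pow R I 2 = I"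
    using prime JJ ideal_pow_2[OF I] by simp
qed

end

section \<open>The prime ideal attached to an ideal\<close>

text \<open>
  The set of all \<open>q\<close> with \<open>qI \<noteq> I\<close>. For an ideal \<open>I\<close> the inclusion \<open>qI \<subseteq> I\<close> always holds, so
  only the failure of \<open>I \<subseteq> qI\<close> is required.
\<close>
definition shrinking_ideal :: "('a, 'b) ring_scheme \<Rightarrow> 'a set \<Rightarrow> 'a set"
  where "shrinking_ideal R I = {q \<in> carrier R. \<not> I \<subseteq> (\<lambda>y. q \<otimes>\<^bsub>R\<^esub> y) ` I}"

context valuation_domain
begin

lemma mem_shrinking_ideal_iff:
  "q \<in> shrinking_ideal R I \<longleftrightarrow> q \<in> carrier R \<and> (\<exists>x\<in>I. \<forall>y\<in>I. x \<noteq> q \<otimes> y)"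
  by (auto simp: shrinking_ideal_def)

lemma not_shrinking_mult:
  assumes I: "ideal I R"
    and s: "s \<in> carrier R - shrinking_ideal R I" and t: "t \<in> carrier R - shrinking_ideal R I"
  shows "s \<otimes> t \<in> carrier R - shrinking_ideal R I"
proof -
  have "\<exists>y\<in>I. x = s \<otimes> t \<otimes> y" if x: "x \<in> I" for x
  proof -
    obtain u where u: "u \<in> I" "x = s \<otimes> u"
      using s x by (auto simp: mem_shrinking_ideal_iff)
    obtain v where v: "v \<in> I" "u = t \<otimes> v"
      using t u(1) by (auto simp: mem_shrinking_ideal_iff)
    have "x = s \<otimes> t \<otimes> v"
      using u v s t ideal.Icarr[OF I v(1)] by (simp add: m_assoc)
    then show ?thesis
      using v(1) by blast
  qed
  then show ?thesis
    using s t by (auto simp: mem_shrinking_ideal_iff)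
qed

lemma shrinking_mult:
  assumes I: "ideal I R" and q: "q \<in> shrinking_ideal R I" and r: "r \<in> carrier R"
  shows "q \<otimes> r \<in> shrinking_ideal R I"
proof -
  obtain x where x: "x \<in> I" "\<And>y. y \<in> I \<Longrightarrow> x \<noteq> q \<otimes> y"
    using q by (auto simp: mem_shrinking_ideal_iff)
  have qc: "q \<in> carrier R"
    using q by (simp add: mem_shrinking_ideal_iff)
  have "x \<noteq> q \<otimes> r \<otimes> y" if "y \<in> I" for y
    using x(2)[of "r \<otimes> y"] ideal.I_l_closed[OF I that r] ideal.Icarr[OF I that] qc r
    by (simp add: m_assoc)
  then show ?thesis
    using x(1) qc r by (auto simp: mem_shrinking_ideal_iff)
qed

lemma zero_mem_shrinking_ideal:
  assumes I: "ideal I R" and nz: "I \<noteq> {\<zero>}"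
  shows "\<zero> \<in> shrinking_ideal R I"
proof -
  have "\<zero> \<in> I"
    using additive_subgroup.zero_closed[OF ideal.axioms(1)[OF I]] .
  then obtain x where "x \<in> I" "x \<noteq> \<zero>"
    using nz by blast
  then show ?thesis
    using ideal.Icarr[OF I] by (auto simp: mem_shrinking_ideal_iff)
qed

lemma shrinking_ideal_primeideal:
  assumes I: "ideal I R" and nz: "I \<noteq> {\<zero>}"
  shows "primeideal (shrinking_ideal R I) R"
proof (rule primeidealI2[OF _ is_cring])
  let ?Q = "shrinking_ideal R I"
  have carr: "q \<in> carrier R" if "q \<in> ?Q" for q
    using that by (simp add: mem_shrinking_ideal_iff)
  have mult: "q \<otimes> r \<in> ?Q" if "q \<in> ?Q" "r \<in> carrier R" for q r
    using shrinking_mult[OF I that] .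
  have multiple: "r \<in> ?Q" if "q \<in> ?Q" "q divides r" for q r
    using that mult by (auto elim: dividesE)
  have add: "q \<oplus> r \<in> ?Q" if q: "q \<in> ?Q" and r: "r \<in> ?Q" and "q divides r" for q r
  proof -
    obtain c where c: "c \<in> carrier R" "r = q \<otimes> c"
      using \<open>q divides r\<close> by (auto elim: dividesE)
    then have "q \<oplus> r = q \<otimes> (\<one> \<oplus> c)"
      using carr[OF q] by (simp add: r_distr)
    then show ?thesis
      using mult[OF q] c(1) by simp
  qed
  show "additive_subgroup ?Q R"
  proof (intro additive_subgroup.intro add.subgroupI)
    show "?Q \<subseteq> carrier R"
      using carr by blast
    show "?Q \<noteq> {}"
      using zero_mem_shrinking_ideal[OF assms] by blast
    show "\<ominus> q \<in> ?Q" if "q \<in> ?Q" for q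
      using mult[OF that, of "\<ominus> \<one>"] carr[OF that] by (simp add: r_minus)
    show "q \<oplus> r \<in> ?Q" if "q \<in> ?Q" "r \<in> ?Q" for q r
      using add[of q r] add[of r q] that divides_total[of q r] carr a_comm by metis
  qed
  show "r \<otimes> q \<in> ?Q" "q \<otimes> r \<in> ?Q" if "q \<in> ?Q" "r \<in> carrier R" for q r
    using mult[OF that] m_comm carr that by simp_all
  have "\<one> \<notin> ?Q"
    using ideal.Icarr[OF I] by (auto simp: mem_shrinking_ideal_iff)
  then show "carrier R \<noteq> ?Q"
    by auto
  show "a \<in> ?Q \<or> b \<in> ?Q" if "a \<in> carrier R" "b \<in> carrier R" "a \<otimes> b \<in> ?Q" for a b
    using not_shrinking_mult[OF I, of a b] that by blast
qed

lemma subset_shrinking_ideal: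
  assumes I: "ideal I R" and proper: "I \<noteq> carrier R" and nz: "I \<noteq> {\<zero>}"
  shows "I \<subseteq> shrinking_ideal R I"
proof
  fix a
  assume a: "a \<in> I"
  show "a \<in> shrinking_ideal R I"
  proof (cases "a = \<zero>")
    case True
    then show ?thesis
      using zero_mem_shrinking_ideal[OF I nz] by simp
  next
    case False
    have ac: "a \<in> carrier R"
      using ideal.Icarr[OF I a] .
    have "a \<noteq> a \<otimes> y" if y: "y \<in> I" for y
    proof
      assume "a = a \<otimes> y"
      then have "\<one> = y"
        using m_lcancel[OF False ac, of \<one> y] ac ideal.Icarr[OF I y] by simp
      then show False
        using ideal.one_imp_carrier[OF I] y proper by simp
    qed
    then show ?thesis
      using a ac by (auto simp: mem_shrinking_ideal_iff)
  qed
qed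

section \<open>The two cases of the closure formula\<close>

text \<open>
  Here \<open>I\<close> becomes principal over the localization at its attached prime, generated by any
  \<open>a \<in> I\<close> outside \<open>IQ\<close>; the multipliers \<open>s \<notin> Q\<close> serve as denominators.
\<close>
lemma ratliff_rush_eq_self:
  assumes I: "ideal I R" and nz: "I \<noteq> {\<zero>}" and ne: "I \<cdot> shrinking_ideal R I \<noteq> I"
  shows "ratliff_rush R I = I"
proof
  show "I \<subseteq> ratliff_rush R I"
    by (rule subset_ratliff_rush[OF I])
next
  define Q where "Q = shrinking_ideal R I"
  have Q: "ideal Q R"
    using shrinking_ideal_primeideal[OF I nz] primeideal.axioms(1) by (simp add: Q_def)
  have Icarr: "x \<in> carrier R" if "x \<in> I" for x
    using ideal.Icarr[OF I that] .
  obtain a where a: "a \<in> I" "a \<notin> I \<cdot> Q"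
    using ne ideal_prod_inter[OF I Q] by (auto simp: Q_def)
  have ac: "a \<in> carrier R"
    using Icarr a(1) .
  have "\<zero> \<in> I \<cdot> Q"
    using additive_subgroup.zero_closed[OF ideal.axioms(1)[OF ideal_prod_is_ideal[OF I Q]]] .
  then have a0: "a \<noteq> \<zero>"
    using a(2) by blast
  have one: "\<one> \<in> carrier R - Q"
    using Icarr by (auto simp: Q_def mem_shrinking_ideal_iff)
  have gen: "\<exists>s\<in>carrier R - Q. a divides (s \<otimes> x)" if x: "x \<in> I" for x
  proof (cases "a divides x")
    case True
    then show ?thesis
      using one Icarr[OF x] by (intro bexI[of _ \<one>]) auto
  next
    case False
    then have "x divides a"
      using divides_total[OF ac Icarr[OF x]] by blast
    then obtain q where q: "q \<in> carrier R" "a = x \<otimes> q"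
      by (auto elim: dividesE)
    then have "q \<notin> Q"
      using a(2) x ideal_prod.prod[of x I q Q R] by blast
    moreover have "a divides (q \<otimes> x)"
      using q Icarr[OF x] ac by (simp add: m_comm)
    ultimately show ?thesis
      using q(1) by blast
  qed
  have gen_pow: "\<exists>s\<in>carrier R - Q. a [^] n divides (s \<otimes> z)" if "z \<in> ideal_pow R I n" for n z
    using that
  proof (induction n arbitrary: z)
    case 0
    then show ?case
      using one by (intro bexI[of _ \<one>]) (auto simp: one_divides)
  next
    case (Suc n)
    obtain w x where wx: "w \<in> ideal_pow R I n" "x \<in> I" "z = w \<otimes> x"
      using mem_ideal_prodE[OF ideal_pow_ideal[OF I] I] Suc.prems by (metis ideal_pow_Suc)
    have wc: "w \<in> carrier R"
      using ideal.Icarr[OF ideal_pow_ideal[OF I] wx(1)] .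
    obtain s where s: "s \<in> carrier R - Q" "a [^] n divides (s \<otimes> w)"
      using Suc.IH[OF wx(1)] by blast
    obtain t where t: "t \<in> carrier R - Q" "a divides (t \<otimes> x)"
      using gen[OF wx(2)] by blast
    obtain c d where cd: "c \<in> carrier R" "s \<otimes> w = a [^] n \<otimes> c" "d \<in> carrier R" "t \<otimes> x = a \<otimes> d"
      using s(2) t(2) by (auto elim!: dividesE)
    have "s \<otimes> t \<otimes> z = (s \<otimes> w) \<otimes> (t \<otimes> x)"
      using s t wc Icarr[OF wx(2)] wx(3) by (simp add: m_ac)
    also have "\<dots> = a [^] Suc n \<otimes> (c \<otimes> d)"
      using cd ac by (simp add: m_ac)
    finally have "a [^] Suc n divides (s \<otimes> t \<otimes> z)"
      using cd by auto
    moreover have "s \<otimes> t \<in> carrier R - Q"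
      using not_shrinking_mult[OF I] s(1) t(1) by (simp add: Q_def)
    ultimately show ?case
      by blast
  qed
  show "ratliff_rush R I \<subseteq> I"
  proof
    fix y
    assume y: "y \<in> ratliff_rush R I"
    obtain n where yc: "y \<in> carrier R"
      and *: "\<And>b. b \<in> ideal_pow R I n \<Longrightarrow> y \<otimes> b \<in> ideal_pow R I (Suc n)"
      using mem_ratliff_rushE[OF y] by blast
    obtain s where s: "s \<in> carrier R - Q" "a [^] Suc n divides (s \<otimes> (y \<otimes> a [^] n))"
      using gen_pow[OF *[OF pow_mem_ideal_pow[OF I a(1)]]] by blast
    obtain c where c: "c \<in> carrier R" "s \<otimes> (y \<otimes> a [^] n) = a [^] Suc n \<otimes> c"
      using s(2) by (auto elim: dividesE)
    have "a [^] n \<otimes> (s \<otimes> y) = a [^] n \<otimes> (a \<otimes> c)"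
      using c s(1) yc ac by (simp add: m_ac)
    moreover have "a [^] n \<noteq> \<zero>"
      using a0 ac by (induction n) (auto simp: integral_iff)
    ultimately have "s \<otimes> y = a \<otimes> c"
      using m_lcancel[of "a [^] n" "s \<otimes> y" "a \<otimes> c"] s(1) yc ac c(1) by simp
    then have "s \<otimes> y \<in> I"
      using ideal.I_r_closed[OF I a(1) c(1)] by simp
    then obtain w where w: "w \<in> I" "s \<otimes> y = s \<otimes> w"
      using s(1) by (auto simp: Q_def mem_shrinking_ideal_iff)
    moreover have "s \<noteq> \<zero>"
      using s(1) zero_mem_shrinking_ideal[OF I nz] by (auto simp: Q_def)
    ultimately have "y = w"
      using m_lcancel[of s y w] s(1) yc Icarr[OF w(1)] by simp
    then show "y \<in> I"
      using w(1) by simp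
  qed
qed

text \<open>
  The reason is that any \<open>x \<in> I\<close> outside \<open>gI\<close> can be written \<open>x = x\<^sub>2 q\<^sub>2 q\<^sub>1\<close> with \<open>x\<^sub>2 \<in> I\<close> and
  \<open>q\<^sub>1, q\<^sub>2 \<in> Q\<close>, by applying \<open>I = IQ\<close> twice; then \<open>g\<close> cannot divide \<open>q\<^sub>1 q\<^sub>2\<close>, so \<open>q\<^sub>1 q\<^sub>2\<close>
  divides \<open>g\<close>, and induction applies to \<open>q\<^sub>1\<close>.
\<close>
lemma ex_pow_divides_shrinking:
  assumes I: "ideal I R" and nz: "I \<noteq> {\<zero>}" and eq: "I \<cdot> shrinking_ideal R I = I"
    and g: "g \<in> shrinking_ideal R I"
  shows "\<exists>h\<in>shrinking_ideal R I. h [^] (n::nat) divides g"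
  using g
proof (induction n arbitrary: g)
  case 0
  then show ?case
    by (intro bexI[of _ g]) (auto simp: mem_shrinking_ideal_iff one_divides)
next
  case (Suc n)
  define Q where "Q = shrinking_ideal R I"
  have Q: "ideal Q R"
    using shrinking_ideal_primeideal[OF I nz] primeideal.axioms(1) by (simp add: Q_def)
  have Qcarr: "q \<in> carrier R" if "q \<in> Q" for q
    using ideal.Icarr[OF Q that] .
  have gQ: "g \<in> Q" and gc: "g \<in> carrier R"
    using Suc.prems Qcarr by (auto simp: Q_def)
  obtain x where x: "x \<in> I" "\<And>y. y \<in> I \<Longrightarrow> x \<noteq> g \<otimes> y"
    using Suc.prems by (auto simp: mem_shrinking_ideal_iff)
  obtain x1 q1 where x1: "x1 \<in> I" "q1 \<in> Q" "x = x1 \<otimes> q1"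
    using mem_ideal_prodE[OF I Q] x(1) eq by (metis Q_def)
  obtain x2 q2 where x2: "x2 \<in> I" "q2 \<in> Q" "x1 = x2 \<otimes> q2"
    using mem_ideal_prodE[OF I Q] x1(1) eq by (metis Q_def)
  have x2c: "x2 \<in> carrier R"
    using ideal.Icarr[OF I x2(1)] .
  note qc = Qcarr[OF x1(2)] Qcarr[OF x2(2)]
  have "\<not> g divides (q1 \<otimes> q2)"
  proof
    assume "g divides (q1 \<otimes> q2)"
    then obtain c where c: "c \<in> carrier R" "q1 \<otimes> q2 = g \<otimes> c"
      by (auto elim: dividesE)
    have "x = (q1 \<otimes> q2) \<otimes> x2"
      using x1(3) x2(3) x2c qc by (simp add: m_ac)
    then have "x = g \<otimes> (c \<otimes> x2)"
      using c gc x2c by (simp add: m_assoc)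
    then show False
      using x(2)[OF ideal.I_l_closed[OF I x2(1) c(1)]] by blast
  qed
  then have q12: "(q1 \<otimes> q2) divides g"
    using divides_total[of g "q1 \<otimes> q2"] gc qc by blast
  obtain h where h: "h \<in> Q" "h [^] n divides q1"
    using Suc.IH[of q1] x1(2) by (auto simp: Q_def)
  \<comment> \<open>\<open>k\<close> is whichever of \<open>h\<close> and \<open>q\<^sub>2\<close> divides the other\<close>
  obtain k where k: "k \<in> Q" "k divides h" "k divides q2"
    using divides_total[of h q2] h(1) x2(2) Qcarr by blast
  note kc = Qcarr[OF k(1)] and hc = Qcarr[OF h(1)]
  have "k [^] n divides q1"
    using divides_trans[OF divides_pow_mono[OF kc hc k(2)] h(2)] kc by simp
  then obtain c d where cd: "c \<in> carrier R" "q1 = k [^] n \<otimes> c" "d \<in> carrier R" "q2 = k \<otimes> d"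
    using k(3) by (auto elim!: dividesE)
  then have "q1 \<otimes> q2 = k [^] Suc n \<otimes> (c \<otimes> d)"
    using kc by (simp add: m_ac)
  then have "k [^] Suc n divides (q1 \<otimes> q2)"
    using cd by auto
  then have "k [^] Suc n divides g"
    using divides_trans[OF _ q12] kc by simp
  then show ?case
    using k(1) by (auto simp: Q_def)
qed

lemma ratliff_rush_eq_colon:
  assumes I: "ideal I R" and nz: "I \<noteq> {\<zero>}" and eq: "I \<cdot> shrinking_ideal R I = I"
  shows "ratliff_rush R I = colon_ideal R I (shrinking_ideal R I)"
proof
  define Q where "Q = shrinking_ideal R I"
  have Q: "ideal Q R"
    using shrinking_ideal_primeideal[OF I nz] primeideal.axioms(1) by (simp add: Q_def)
  have Icarr: "x \<in> carrier R" if "x \<in> I" for x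
    using ideal.Icarr[OF I that] .
  have Qcarr: "q \<in> carrier R" if "q \<in> Q" for q
    using ideal.Icarr[OF Q that] .
  have "colon_ideal R I Q \<subseteq> ratliff_rush R I"
  proof
    fix y
    assume y: "y \<in> colon_ideal R I Q"
    then have yc: "y \<in> carrier R"
      by (simp add: colon_ideal_def)
    show "y \<in> ratliff_rush R I"
    proof (rule ratliff_rushI_square[OF I yc])
      fix x
      assume "x \<in> I"
      then obtain u q where uq: "u \<in> I" "q \<in> Q" "x = u \<otimes> q"
        using mem_ideal_prodE[OF I Q] eq by (metis Q_def)
      then have "y \<otimes> x = u \<otimes> (y \<otimes> q)"
        using yc Icarr Qcarr by (simp add: m_ac)
      moreover have "y \<otimes> q \<in> I"
        using y uq(2) by (simp add: colon_ideal_def)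
      ultimately show "y \<otimes> x \<in> I \<cdot> I"
        using uq(1) by (simp add: ideal_prod.prod)
    qed
  qed
  then show "colon_ideal R I (shrinking_ideal R I) \<subseteq> ratliff_rush R I"
    by (simp add: Q_def)
  have "y \<otimes> g \<in> I" if y: "y \<in> ratliff_rush R I" and g: "g \<in> Q" for y g
  proof -
    obtain n where yc: "y \<in> carrier R"
      and *: "\<And>b. b \<in> ideal_pow R I n \<Longrightarrow> y \<otimes> b \<in> ideal_pow R I (Suc n)"
      using mem_ratliff_rushE[OF y] by blast
    obtain h where h: "h \<in> Q" "h [^] n divides g"
      using ex_pow_divides_shrinking[OF I nz eq, of g n] g by (auto simp: Q_def)
    have hc: "h \<in> carrier R"
      using Qcarr h(1) .
    obtain x where x: "x \<in> I" "\<And>w. w \<in> I \<Longrightarrow> x \<noteq> h \<otimes> w"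
      using h(1) by (auto simp: Q_def mem_shrinking_ideal_iff)
    have xc: "x \<in> carrier R"
      using Icarr x(1) .
    have x_dvd: "x divides (h \<otimes> w)" if w: "w \<in> I" for w
    proof (rule ccontr)
      assume "\<not> x divides (h \<otimes> w)"
      then have "(h \<otimes> w) divides x"
        using divides_total[of x "h \<otimes> w"] xc hc Icarr[OF w] by blast
      then obtain c where c: "c \<in> carrier R" "x = h \<otimes> w \<otimes> c"
        by (auto elim: dividesE)
      then have "x = h \<otimes> (w \<otimes> c)"
        using hc Icarr[OF w] by (simp add: m_assoc)
      then show False
        using x(2)[OF ideal.I_r_closed[OF I w c(1)]] by blast
    qed
    have x_pow_dvd: "x [^] k divides (h [^] k \<otimes> z)" if "z \<in> ideal_pow R I k" for k z
      using that
    proof (induction k arbitrary: z)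
      case 0
      then show ?case
        by (auto simp: one_divides)
    next
      case (Suc k)
      obtain v w where vw: "v \<in> ideal_pow R I k" "w \<in> I" "z = v \<otimes> w"
        using mem_ideal_prodE[OF ideal_pow_ideal[OF I] I] Suc.prems by (metis ideal_pow_Suc)
      have vc: "v \<in> carrier R"
        using ideal.Icarr[OF ideal_pow_ideal[OF I] vw(1)] .
      obtain c d where cd: "c \<in> carrier R" "h [^] k \<otimes> v = x [^] k \<otimes> c"
        "d \<in> carrier R" "h \<otimes> w = x \<otimes> d"
        using Suc.IH[OF vw(1)] x_dvd[OF vw(2)] by (auto elim!: dividesE)
      have "h [^] Suc k \<otimes> z = (h [^] k \<otimes> v) \<otimes> (h \<otimes> w)"
        using vw(3) vc hc Icarr[OF vw(2)] by (simp add: m_ac)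
      also have "\<dots> = x [^] Suc k \<otimes> (c \<otimes> d)"
        using cd xc by (simp add: m_ac)
      finally show ?case
        using cd by auto
    qed
    obtain w z where wz: "w \<in> ideal_pow R I n" "z \<in> I" "y \<otimes> x [^] n = w \<otimes> z"
      using mem_ideal_prodE[OF ideal_pow_ideal[OF I] I] *[OF pow_mem_ideal_pow[OF I x(1)]]
      by (metis ideal_pow_Suc)
    have wc: "w \<in> carrier R"
      using ideal.Icarr[OF ideal_pow_ideal[OF I] wz(1)] .
    note zc = Icarr[OF wz(2)]
    obtain c where c: "c \<in> carrier R" "h [^] n \<otimes> w = x [^] n \<otimes> c"
      using x_pow_dvd[OF wz(1)] by (auto elim: dividesE)
    have "x [^] n \<otimes> (y \<otimes> h [^] n) = h [^] n \<otimes> (y \<otimes> x [^] n)"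
      using xc yc hc by (simp add: m_ac)
    also have "\<dots> = (h [^] n \<otimes> w) \<otimes> z"
      using wz(3) hc wc zc by (simp add: m_assoc)
    also have "\<dots> = x [^] n \<otimes> (z \<otimes> c)"
      using c xc zc by (simp add: m_ac)
    finally have eq': "x [^] n \<otimes> (y \<otimes> h [^] n) = x [^] n \<otimes> (z \<otimes> c)" .
    have "x \<noteq> \<zero>"
      using x(2)[of \<zero>] hc additive_subgroup.zero_closed[OF ideal.axioms(1)[OF I]] by auto
    then have "x [^] n \<noteq> \<zero>"
      using xc by (induction n) (auto simp: integral_iff)
    then have "y \<otimes> h [^] n = z \<otimes> c"
      using eq' m_lcancel[of "x [^] n" "y \<otimes> h [^] n" "z \<otimes> c"] xc yc hc zc c(1) by simp
    then have "y \<otimes> h [^] n \<in> I"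
      using ideal.I_r_closed[OF I wz(2) c(1)] by simp
    moreover have "(y \<otimes> h [^] n) divides (y \<otimes> g)"
      using h(2) yc hc by (intro divides_mult_lI) auto
    ultimately show ?thesis
      by (rule mem_ideal_if_divides[OF I])
  qed
  then show "ratliff_rush R I \<subseteq> colon_ideal R I (shrinking_ideal R I)"
    using ratliff_rush_subset_carrier by (auto simp: colon_ideal_def Q_def)
qed

end

section \<open>The Ratliff-Rush closure in a valuation domain\<close>

theorem proposition3p2:
  fixes V (structure) and I :: "'a set"
  assumes "valuation_domain V"
    and "ideal I V"
    and "I \<noteq> {\<zero>}"
  shows "(I \<noteq> carrier V \<longrightarrow>
            (ratliff_rush V I = carrier V \<longleftrightarrow> primeideal I V \<and> ideal_pow V I 2 = I)) \<and>
         (ratliff_rush V I \<subset> carrier V \<longrightarrow>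
            ratliff_rush V I = I \<or>
            (\<exists>Q. primeideal Q V \<and> Q \<noteq> {\<zero>} \<and> ratliff_rush V I = colon_ideal V (I \<cdot> Q) Q))"
proof (intro conjI impI)
  interpret valuation_domain V
    by (rule assms(1))
  show "ratliff_rush V I = carrier V \<longleftrightarrow> primeideal I V \<and> ideal_pow V I 2 = I"
    if "I \<noteq> carrier V"
    using ratliff_rush_eq_carrier_iff[OF assms(2) that] .
  show "ratliff_rush V I = I \<or>
      (\<exists>Q. primeideal Q V \<and> Q \<noteq> {\<zero>} \<and> ratliff_rush V I = colon_ideal V (I \<cdot> Q) Q)"
    if "ratliff_rush V I \<subset> carrier V"
  proof (cases "I \<cdot> shrinking_ideal V I = I")
    case False
    then show ?thesis
      using ratliff_rush_eq_self[OF assms(2,3)] by blast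
  next
    case True
    have "I \<noteq> carrier V"
      using that subset_ratliff_rush[OF assms(2)] by blast
    then have "I \<subseteq> shrinking_ideal V I"
      using subset_shrinking_ideal assms(2,3) by blast
    moreover have "\<zero> \<in> I"
      using additive_subgroup.zero_closed[OF ideal.axioms(1)[OF assms(2)]] .
    ultimately have "shrinking_ideal V I \<noteq> {\<zero>}"
      using assms(3) by blast
    then show ?thesis
      using shrinking_ideal_primeideal[OF assms(2,3)] ratliff_rush_eq_colon[OF assms(2,3) True]
        True by metis
  qed
qed

end
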